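(* Let $F\in\mathbb{N}\setminus\{0\}$ and $S\in\mathcal{A}(F)$. Then $\mathcal{A}(F)_{\mathrm{rank}}(S)\leq m(S)-1$.
   Context: Let $\mathbb{N}=\{0,1,2,\dots\}$. A numerical semigroup is a subset $S\subseteq\mathbb{N}$ that contains $0$, is closed under addition, and has finite complement $\mathbb{N}\setminus S$. Its multiplicity is $m(S)=\min(S\setminus\{0\})$ and its Frobenius number is $F(S)=\max\{z\in\mathbb{Z}\mid z\notin S\}$. For $F\in\mathbb{N}\setminus\{0\}$, $\mathcal{A}(F)$ is the set of all numerical semigroups with Frobenius number $F$; its minimum with respect to inclusion is $\Delta(\mathcal{A}(F))=\{0\}\cup\{z\in\mathbb{N}\mid z\ge F+1\}$. An $\mathcal{A}(F)$-set is a subset of $M\setminus\Delta(\mathcal{A}(F))$ for some maximal (with respect to inclusion) element $M$ of $\mathcal{A}(F)$. For an $\mathcal{A}(F)$-set $A$, $\mathcal{A}(F)(A)$ denotes the intersection of all elements of $\mathcal{A}(F)$ containing $A$ (it is the least element of $\mathcal{A}(F)$ containing $A$). For $S\in\mathcal{A}(F)$, its $\mathcal{A}(F)$-rank is $\mathcal{A}(F)_{\mathrm{rank}}(S)=\min\{\sharp A\mid A\text{ is an }\mathcal{A}(F)\text{-set and }\mathcal{A}(F)(A)=S\}$, where $\sharp A$ denotes the cardinality of $A$. *)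

theory Defs
  imports Main
begin

definition numerical_semigroup :: "nat set \<Rightarrow> bool" where
  "numerical_semigroup S \<longleftrightarrow>
     0 \<in> S \<and> (\<forall>x\<in>S. \<forall>y\<in>S. x + y \<in> S) \<and> finite (- S)"

definition sg_multiplicity :: "nat set \<Rightarrow> nat" where
  "sg_multiplicity S = (LEAST n. n \<in> S - {0})"

(* The maximum is taken over the integers, so the Frobenius number of UNIV is -1.
   Max is not usable here: the set of integers outside S is infinite. *)
definition frobenius :: "nat set \<Rightarrow> int" where
  "frobenius S = (GREATEST z. z \<notin> int ` S)"

definition frob_class :: "nat \<Rightarrow> nat set set" where
  "frob_class F = {S. numerical_semigroup S \<and> frobenius S = int F}"

(* The inclusion-minimum of frob_class F; see frob_min_least. *)
definition frob_min :: "nat \<Rightarrow> nat set" where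
  "frob_min F = {0} \<union> {F + 1..}"

definition frob_maximal :: "nat \<Rightarrow> nat set \<Rightarrow> bool" where
  "frob_maximal F M \<longleftrightarrow>
     M \<in> frob_class F \<and> (\<forall>T\<in>frob_class F. M \<subseteq> T \<longrightarrow> T = M)"

definition frob_set :: "nat \<Rightarrow> nat set \<Rightarrow> bool" where
  "frob_set F A \<longleftrightarrow> (\<exists>M. frob_maximal F M \<and> A \<subseteq> M - frob_min F)"

definition frob_gen :: "nat \<Rightarrow> nat set \<Rightarrow> nat set" where
  "frob_gen F A = \<Inter>{T \<in> frob_class F. A \<subseteq> T}"

(* For S in frob_class F, the set S - frob_min F is itself a frob_set generating S, so the
   minimum exists; every frob_set is finite, being contained in {1..F}, so card is faithful. *)
definition frob_rank :: "nat \<Rightarrow> nat set \<Rightarrow> nat" where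
  "frob_rank F S = (LEAST n. \<exists>A. frob_set F A \<and> frob_gen F A = S \<and> card A = n)"

lemma frobenius_eq_iff:
  assumes "numerical_semigroup S"
  shows "frobenius S = int F \<longleftrightarrow> F \<notin> S \<and> {F + 1..} \<subseteq> S"
proof
  assume R: "F \<notin> S \<and> {F + 1..} \<subseteq> S"
  show "frobenius S = int F"
    unfolding frobenius_def
  proof (rule Greatest_equality)
    show "int F \<notin> int ` S" using R by auto
    fix z assume z: "z \<notin> int ` S"
    show "z \<le> int F"
    proof (rule ccontr)
      assume "\<not> z \<le> int F"
      then have "nat z \<in> S" "z = int (nat z)" using R by auto
      with z show False by blast
    qed
  qed
next
  assume L: "frobenius S = int F"
  define G where "G = (if - S = {} then - 1 else int (Max (- S)))"
  have fin: "finite (- S)" using assms by (simp add: numerical_semigroup_def)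
  have G1: "G \<notin> int ` S"
  proof (cases "- S = {}")
    case False
    then have "Max (- S) \<notin> S" using Max_in[OF fin] by blast
    then show ?thesis using False by (auto simp: G_def)
  qed (auto simp: G_def)
  have G2: "z \<le> G" if z: "z \<notin> int ` S" for z
  proof (cases "z < 0")
    case True
    then show ?thesis by (auto simp: G_def)
  next
    case False
    then have zz: "z = int (nat z)" by simp
    then have "nat z \<in> - S" using z by (metis ComplI imageI)
    then have "nat z \<le> Max (- S)" "- S \<noteq> {}" using Max_ge[OF fin] by blast+
    then show ?thesis using zz by (simp add: G_def)
  qed
  have "frobenius S = G"
    unfolding frobenius_def using G1 G2 by (rule Greatest_equality)
  then have "G = int F" using L by simp
  then show "F \<notin> S \<and> {F + 1..} \<subseteq> S"
  proof (intro conjI subsetI)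
    fix x assume "x \<in> {F + 1..}"
    then show "x \<in> S" using G2[of "int x"] \<open>G = int F\<close> by force
  qed (use G1 \<open>G = int F\<close> in auto)
qed

lemma frob_min_least:
  assumes "F \<noteq> 0"
  shows "frob_min F \<in> frob_class F" and "\<forall>T\<in>frob_class F. frob_min F \<subseteq> T"
proof -
  have "- frob_min F \<subseteq> {..F}" by (auto simp: frob_min_def)
  then have "finite (- frob_min F)" using finite_subset by blast
  then have "numerical_semigroup (frob_min F)"
    by (auto simp: numerical_semigroup_def frob_min_def)
  then show "frob_min F \<in> frob_class F"
    using assms by (auto simp: frob_class_def frobenius_eq_iff frob_min_def)
  show "\<forall>T\<in>frob_class F. frob_min F \<subseteq> T"
  proof
    fix T assume "T \<in> frob_class F"
    then have "numerical_semigroup T" "frobenius T = int F"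
      by (auto simp: frob_class_def)
    then show "frob_min F \<subseteq> T"
      using frobenius_eq_iff[of T F]
      by (auto simp: frob_min_def numerical_semigroup_def)
  qed
qed

end

theory Submission
  imports Defs
begin

text \<open>
  Let \<open>m\<close> be the multiplicity of \<open>S\<close>. The element \<open>m\<close> together with the elements \<open>s\<close> of \<open>S\<close>
  such that \<open>s - m\<close> is not in \<open>S\<close> generates \<open>S\<close>, and it contains at most one positive element of
  each residue class modulo \<open>m\<close>. Only those not exceeding \<open>F\<close> are needed, and none of these is
  congruent to \<open>F\<close>, since otherwise adding multiples of \<open>m\<close> would put \<open>F\<close> in \<open>S\<close>. This leaves
  \<open>m - 1\<close> classes.
\<close>

lemma frob_class_iff:
  "S \<in> frob_class F \<longleftrightarrow> numerical_semigroup S \<and> F \<notin> S \<and> {F + 1..} \<subseteq> S"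
  by (auto simp: frob_class_def frobenius_eq_iff)

text \<open>A member is determined by its complement, which lies in \<open>{..F}\<close>. So the
  class is finite, and every member lies below a maximal one.\<close>

lemma frob_maximal_superset:
  assumes "S \<in> frob_class F"
  obtains M where "frob_maximal F M" and "S \<subseteq> M"
proof -
  have "frob_class F \<subseteq> {T. {F + 1..} \<subseteq> T}"
    by (auto simp: frob_class_iff)
  also have "\<dots> \<subseteq> uminus ` Pow {..F}"
  proof
    fix T :: "nat set" assume "T \<in> {T. {F + 1..} \<subseteq> T}"
    then have "- T \<subseteq> {..F}" by (auto simp: Suc_le_eq subset_iff not_le [symmetric])
    then show "T \<in> uminus ` Pow {..F}" by (metis PowI double_compl imageI)
  qed
  finally have "finite (frob_class F)"
    by (rule finite_subset) simp
  from finite_has_maximal2[OF this assms] show thesis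
    using that by (auto simp: frob_maximal_def)
qed

lemma numerical_semigroup_mult_add:
  assumes "numerical_semigroup S" "m \<in> S" "s \<in> S"
  shows "s + k * m \<in> S"
proof (induction k)
  case (Suc k)
  then have "(s + k * m) + m \<in> S"
    using assms by (auto simp: numerical_semigroup_def)
  then show ?case by (simp add: algebra_simps)
qed (use assms in simp)

lemma numerical_semigroup_mod_eq:
  assumes "numerical_semigroup S" "m \<in> S" "s \<in> S" "s \<le> t" "s mod m = t mod m"
  shows "t \<in> S"
proof -
  obtain k where "t = s + k * m"
    using assms(4,5) by (metis mod_eq_nat1E mult.commute)
  then show ?thesis using numerical_semigroup_mult_add[OF assms(1-3)] by simp
qed

text \<open>The \<open>LEAST\<close> is attained: a cofinite set of naturals is infinite, so it has
  a positive element.\<close>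

lemma sg_multiplicity:
  assumes "numerical_semigroup S"
  shows "sg_multiplicity S \<in> S" "0 < sg_multiplicity S"
    and "s \<in> S \<Longrightarrow> 0 < s \<Longrightarrow> sg_multiplicity S \<le> s"
proof -
  have "infinite (S - {0})"
    using assms finite_compl by (auto simp: numerical_semigroup_def)
  then obtain n where "n \<in> S - {0}" by (metis all_not_in_conv finite.emptyI)
  then have "sg_multiplicity S \<in> S - {0}"
    unfolding sg_multiplicity_def by (rule LeastI)
  then show "sg_multiplicity S \<in> S" "0 < sg_multiplicity S" by auto
  show "sg_multiplicity S \<le> s" if "s \<in> S" "0 < s"
    unfolding sg_multiplicity_def using that by (intro Least_le) auto
qed

lemma frob_rank_le:
  assumes "frob_set F A" "frob_gen F A = S"
  shows "frob_rank F S \<le> card A"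
  unfolding frob_rank_def using assms by (intro Least_le) blast

text \<open>The Apery set of \<open>S\<close> with respect to its multiplicity, with 0 replaced by
  the multiplicity, cut off at \<open>F\<close>. Truncated subtraction is harmless, as no positive
  element of \<open>S\<close> is below the multiplicity.\<close>

definition kunz_gens :: "nat \<Rightarrow> nat set \<Rightarrow> nat set" where
  "kunz_gens F S =
     {s \<in> S. 0 < s \<and> s \<le> F \<and> (s = sg_multiplicity S \<or> s - sg_multiplicity S \<notin> S)}"

lemma frob_set_kunz_gens:
  assumes "S \<in> frob_class F"
  shows "frob_set F (kunz_gens F S)"
proof -
  obtain M where "frob_maximal F M" "S \<subseteq> M"
    using frob_maximal_superset[OF assms] .
  then show ?thesis
    by (auto simp: frob_set_def kunz_gens_def frob_min_def)
qed

lemma frob_gen_kunz_gens: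
  assumes S: "S \<in> frob_class F"
  shows "frob_gen F (kunz_gens F S) = S"
proof
  show "frob_gen F (kunz_gens F S) \<subseteq> S"
    using S by (auto simp: frob_gen_def kunz_gens_def)
  let ?m = "sg_multiplicity S"
  have sg: "numerical_semigroup S" using S by (simp add: frob_class_iff)
  \<comment> \<open>Descent by \<open>?m\<close>: an element up to \<open>F\<close> that is neither
    0 nor a generator is \<open>?m\<close> plus a smaller element of \<open>S\<close>.\<close>
  have "s \<in> T" if T: "T \<in> frob_class F" "kunz_gens F S \<subseteq> T" and "s \<in> S" for T s
    using \<open>s \<in> S\<close>
  proof (induction s rule: less_induct)
    case (less s)
    have add: "x + y \<in> T" if "x \<in> T" "y \<in> T" for x y
      using T that by (auto simp: frob_class_iff numerical_semigroup_def)
    consider "s = 0" | "F < s" | "0 < s" "s \<le> F" "s \<in> kunz_gens F S"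
      | "0 < s" "s \<le> F" "s - ?m \<in> S"
      using less.prems unfolding kunz_gens_def by (cases "s = 0"; cases "s \<le> F") auto
    then show ?case
    proof cases
      case 4
      have le: "?m \<le> s" using sg_multiplicity(3)[OF sg less.prems 4(1)] .
      \<comment> \<open>Since \<open>?m\<close> \<le> \<open>s\<close> \<le> \<open>F\<close>, the
        multiplicity survives the cut-off and is itself a generator.\<close>
      then have "?m \<in> T"
        using T(2) 4(2) sg_multiplicity(1,2)[OF sg] by (auto simp: kunz_gens_def)
      moreover have "s - ?m \<in> T"
        using less.IH 4 sg_multiplicity(2)[OF sg] by simp
      ultimately show ?thesis using add[of "s - ?m" ?m] le by simp
    qed (use T in \<open>auto simp: frob_class_iff numerical_semigroup_def\<close>)
  qed
  then show "S \<subseteq> frob_gen F (kunz_gens F S)"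
    by (auto simp: frob_gen_def)
qed

lemma card_kunz_gens:
  assumes S: "S \<in> frob_class F"
  shows "card (kunz_gens F S) \<le> sg_multiplicity S - 1"
proof -
  let ?m = "sg_multiplicity S"
  have sg: "numerical_semigroup S" and F: "F \<notin> S"
    using S by (auto simp: frob_class_iff)
  note m = sg_multiplicity[OF sg]
  have neq: "s mod ?m \<noteq> t mod ?m"
    if s: "s \<in> kunz_gens F S" and t: "t \<in> kunz_gens F S" and "s < t" for s t
  proof
    assume eq: "s mod ?m = t mod ?m"
    \<comment> \<open>This excludes \<open>t = ?m\<close>, so \<open>t\<close> must be a generator
      because \<open>t - ?m\<close> is outside \<open>S\<close>. But congruence puts
      \<open>t - ?m\<close> at or above \<open>s\<close> in the same class, hence in
      \<open>S\<close>.\<close>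
    have "?m \<le> s" using s m(3) by (simp add: kunz_gens_def)
    then have "t - ?m \<notin> S" using t \<open>s < t\<close> by (auto simp: kunz_gens_def)
    moreover have "s \<le> t - ?m"
      using eq \<open>s < t\<close> by (metis add_le_imp_le_diff dvd_imp_le le_diff_conv2 less_imp_le_nat
        mod_eq_dvd_iff_nat zero_less_diff add.commute)
    moreover have "s mod ?m = (t - ?m) mod ?m"
      using eq \<open>?m \<le> s\<close> \<open>s < t\<close> by (simp add: le_mod_geq)
    ultimately show False
      using numerical_semigroup_mod_eq[OF sg m(1), of s "t - ?m"] s
      by (simp add: kunz_gens_def)
  qed
  have "inj_on (\<lambda>s. s mod ?m) (kunz_gens F S)"
    by (rule inj_onI) (metis neq linorder_neqE_nat)
  \<comment> \<open>The cut-off at \<open>F\<close> matters here: only a generator not exceeding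
    \<open>F\<close> can reach \<open>F\<close> by adding multiples of \<open>?m\<close>.\<close>
  moreover have "(\<lambda>s. s mod ?m) ` kunz_gens F S \<subseteq> {..<?m} - {F mod ?m}"
    using numerical_semigroup_mod_eq[OF sg m(1)] F m(2) by (auto simp: kunz_gens_def)
  ultimately have "card (kunz_gens F S) \<le> card ({..<?m} - {F mod ?m})"
    by (rule card_inj_on_le) simp
  also have "\<dots> = ?m - 1"
    using m(2) by (simp add: card_Diff_singleton)
  finally show ?thesis .
qed

theorem proposition6p13:
  fixes F :: nat and S :: "nat set"
  assumes "F \<noteq> 0" and "S \<in> frob_class F"
  shows "frob_rank F S \<le> sg_multiplicity S - 1"
  using frob_rank_le[OF frob_set_kunz_gens frob_gen_kunz_gens] card_kunz_gens assms(2)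
  by (meson order_trans)

end
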